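(* Let $\mathbb{T}$ be a time scale, $\alpha\in(0,1]$, $a,b\in\mathbb{T}$ and $p>1$. If $f,g,h:[a,b]\to\mathbb{R}$ are rd-continuous, then $$\left[\int_a^b|(f+g)(t)|^p|h(t)|\,\Delta^\alpha t\right]^{\frac1p}\le\left[\int_a^b|f(t)|^p|h(t)|\,\Delta^\alpha t\right]^{\frac1p}+\left[\int_a^b|g(t)|^p|h(t)|\,\Delta^\alpha t\right]^{\frac1p}.$$
   Context: A time scale $\mathbb{T}$ is a nonempty closed subset of $\mathbb{R}$. Here $[a,b]$ denotes the time-scale interval $\{t\in\mathbb{T}:a\le t\le b\}$. A function is rd-continuous if it is continuous at right-dense points and has finite left-sided limits at left-dense points. The $\alpha$-fractional integral of a function $f$ is $\int f(t)\,\Delta^\alpha t:=\int f(t)\,t^{\alpha-1}\,\Delta t$, where the right-hand side is the usual (indefinite) Hilger delta-integral on $\mathbb{T}$. Writing $F_\alpha(t)=\int f(t)\,\Delta^\alpha t$, the Cauchy $\alpha$-fractional integral is $\int_a^b f(t)\,\Delta^\alpha t:=F_\alpha(b)-F_\alpha(a)$ for $a,b\in\mathbb{T}$.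
   Formalization: If α<1 and 0∈[a,b], where t^(α-1) is undefined and the integrals may not exist, the formal theorem also assumes that the weight t^(α-1) has a delta integral on [a,b]; for α<1 the weight at t≤0 is fixed by convention (0 at t=0). *)

theory Defs
  imports "HOL-Analysis.Analysis"
begin

definition time_scale :: "real set \<Rightarrow> bool" where
  "time_scale T \<longleftrightarrow> T \<noteq> {} \<and> closed T"

text \<open>For points of \<open>T\<close> with \<open>a \<le> b\<close> this is again a time scale. A function
  given only on \<open>[a,b]\<close> is treated as a function on this time scale; its values elsewhere
  play no role.\<close>

definition ts_interval :: "real set \<Rightarrow> real \<Rightarrow> real \<Rightarrow> real set" where
  "ts_interval T a b = {t \<in> T. a \<le> t \<and> t \<le> b}"

text \<open>The second branches realise the usual conventions \<open>inf {} = sup T\<close> and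
  \<open>sup {} = inf T\<close>: a maximum is fixed by the forward jump and a minimum by the
  backward jump.\<close>

definition fwd_jump :: "real set \<Rightarrow> real \<Rightarrow> real" where
  "fwd_jump T t = (if \<exists>s\<in>T. t < s then Inf {s \<in> T. t < s} else t)"

definition bwd_jump :: "real set \<Rightarrow> real \<Rightarrow> real" where
  "bwd_jump T t = (if \<exists>s\<in>T. s < t then Sup {s \<in> T. s < t} else t)"

definition right_scattered :: "real set \<Rightarrow> real \<Rightarrow> bool" where
  "right_scattered T t \<longleftrightarrow> t \<in> T \<and> t < fwd_jump T t"

definition left_scattered :: "real set \<Rightarrow> real \<Rightarrow> bool" where
  "left_scattered T t \<longleftrightarrow> t \<in> T \<and> bwd_jump T t < t"

text \<open>A maximum does not count as right-dense, nor a minimum as left-dense.\<close>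

definition right_dense :: "real set \<Rightarrow> real \<Rightarrow> bool" where
  "right_dense T t \<longleftrightarrow> t \<in> T \<and> (\<exists>s\<in>T. t < s) \<and> fwd_jump T t = t"

definition left_dense :: "real set \<Rightarrow> real \<Rightarrow> bool" where
  "left_dense T t \<longleftrightarrow> t \<in> T \<and> (\<exists>s\<in>T. s < t) \<and> bwd_jump T t = t"

definition rd_continuous :: "real set \<Rightarrow> (real \<Rightarrow> real) \<Rightarrow> bool" where
  "rd_continuous T f \<longleftrightarrow>
     (\<forall>t. right_dense T t \<longrightarrow> continuous (at t within T) f) \<and>
     (\<forall>t. left_dense T t \<longrightarrow> (\<exists>l. (f \<longlongrightarrow> l) (at t within (T \<inter> {..<t}))))"

text \<open>The set \<open>T\<^sup>\<kappa>\<close>: \<open>T\<close> without its maximum if that maximum is left-scattered.\<close>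

definition ts_kappa :: "real set \<Rightarrow> real set" where
  "ts_kappa T = T - {m. left_scattered T m \<and> (\<forall>s\<in>T. s \<le> m)}"

definition has_delta_derivative :: "real set \<Rightarrow> (real \<Rightarrow> real) \<Rightarrow> real \<Rightarrow> real \<Rightarrow> bool" where
  "has_delta_derivative T F D t \<longleftrightarrow>
     (\<forall>\<epsilon>>0. \<exists>\<delta>>0. \<forall>s\<in>T. \<bar>s - t\<bar> < \<delta> \<longrightarrow>
        \<bar>F (fwd_jump T t) - F s - D * (fwd_jump T t - s)\<bar> \<le> \<epsilon> * \<bar>fwd_jump T t - s\<bar>)"

text \<open>Pre-antiderivatives in the sense of Hilger: \<open>F\<close> is continuous, and its delta derivative
  is \<open>f\<close> on a region \<open>D\<close> of differentiation, which omits at most countably many points of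
  \<open>T\<^sup>\<kappa>\<close>, none of them right-scattered.\<close>

definition pre_antiderivative ::
    "real set \<Rightarrow> (real \<Rightarrow> real) \<Rightarrow> (real \<Rightarrow> real) \<Rightarrow> bool" where
  "pre_antiderivative T f F \<longleftrightarrow>
     continuous_on T F \<and>
     (\<exists>D \<subseteq> ts_kappa T.
        countable (ts_kappa T - D) \<and>
        (\<forall>t \<in> ts_kappa T - D. \<not> right_scattered T t) \<and>
        (\<forall>t \<in> D. has_delta_derivative T F (f t) t))"

definition delta_integrable :: "real set \<Rightarrow> (real \<Rightarrow> real) \<Rightarrow> bool" where
  "delta_integrable T f \<longleftrightarrow> (\<exists>F. pre_antiderivative T f F)"

text \<open>Pre-antiderivatives are determined on \<open>T\<close> up to an additive constant; an arbitrary one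
  is selected.\<close>

definition delta_indef_integral :: "real set \<Rightarrow> (real \<Rightarrow> real) \<Rightarrow> real \<Rightarrow> real" where
  "delta_indef_integral T f = (SOME F. pre_antiderivative T f F)"

text \<open>The weight \<open>t\<^sup>\<alpha>\<^sup>-\<^sup>1\<close>. The case \<open>\<alpha> = 1\<close> is separated because \<open>0 powr 0 = 0\<close> in
  the library, whereas the weight has to be constantly \<open>1\<close> there, so that the plain delta
  integral is recovered. For \<open>\<alpha> < 1\<close> the power has its usual meaning for \<open>t > 0\<close>; the
  library convention gives \<open>\<bar>t\<bar> powr (\<alpha> - 1)\<close> for \<open>t < 0\<close> and \<open>0\<close> for \<open>t = 0\<close>.
  If the weight is singular at a point \<open>0\<close> of the time scale, it need not be delta integrable
  there: on \<open>{0} \<union> {2 powr - (2 ^ n) | n}\<close> with \<open>\<alpha> < 1/2\<close> no pre-antiderivative exists.\<close>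

definition frac_weight :: "real \<Rightarrow> real \<Rightarrow> real" where
  "frac_weight \<alpha> t = (if \<alpha> = 1 then 1 else t powr (\<alpha> - 1))"

definition frac_indef_integral :: "real set \<Rightarrow> real \<Rightarrow> (real \<Rightarrow> real) \<Rightarrow> real \<Rightarrow> real" where
  "frac_indef_integral T \<alpha> f = delta_indef_integral T (\<lambda>t. f t * frac_weight \<alpha> t)"

definition frac_integral ::
    "real set \<Rightarrow> real \<Rightarrow> real \<Rightarrow> real \<Rightarrow> (real \<Rightarrow> real) \<Rightarrow> real" where
  "frac_integral T \<alpha> a b f = frac_indef_integral T \<alpha> f b - frac_indef_integral T \<alpha> f a"

end

theory Submission
  imports Defs
begin

text \<open>
  Minkowski's inequality needs only two properties of an integral: it is linear and monotone. For
  \<open>A, B > 0\<close>, convexity of \<open>u \<mapsto> u\<^sup>p\<close> gives pointwise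
  \<open>\<bar>x + y\<bar>\<^sup>p \<le> (A + B)\<^sup>p\<^sup>-\<^sup>1 (A\<^sup>1\<^sup>-\<^sup>p \<bar>x\<bar>\<^sup>p + B\<^sup>1\<^sup>-\<^sup>p \<bar>y\<bar>\<^sup>p)\<close>
  (\<open>powr_add_le_weighted\<close>). After integration, the right-hand side is at most \<open>(A + B)\<^sup>p\<close> as soon
  as \<open>A\<close> and \<open>B\<close> exceed the two norms on the right of the claim; letting \<open>A\<close> and \<open>B\<close> decrease to
  these norms proves it, also when one of them vanishes (\<open>powr_inverse_le_add\<close>).

  The work lies in showing that the delta integral, given by an arbitrarily selected
  pre-antiderivative, is linear and monotone, and that the pre-antiderivatives in question exist.
  Both follow from a comparison with the Henstock-Kurzweil integral. A function \<open>f\<close> on a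
  compact time scale \<open>K\<close> with endpoints \<open>a\<close> and \<open>b\<close> is extended to \<open>[a,b]\<close> as a step function, whose value
  at \<open>x\<close> is the value of \<open>f\<close> at the last point of \<open>K\<close> not after \<open>x\<close>.

  If \<open>F\<close> is any pre-antiderivative of \<open>f\<close>, then \<open>F b - F a\<close> is the Henstock-Kurzweil integral of this
  step extension (\<open>pre_antiderivative_has_integral\<close>). Indeed, \<open>F\<close>, extended to be affine on every gap of \<open>K\<close>, is
  continuous and has the step extension as derivative outside a countable set, so that a
  version of the fundamental theorem of calculus with countably many exceptional points applies.

  Conversely, if the step extension is integrable and \<open>f\<close> is continuous at all right-dense points
  with at most countably many exceptions, its indefinite integral is a pre-antiderivative
  (\<open>pre_antiderivative_integral\<close>). For an rd-continuous \<open>f\<close> times the weight \<open>w\<close>, integrability is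
  obtained by domination: the extension of \<open>w\<close> is integrable by the first direction, hence
  absolutely integrable as \<open>w \<ge> 0\<close>, and the extension of \<open>f\<close> is bounded and measurable
  (\<open>delta_integrable_rd_continuous_mult\<close>). This also covers a weight that is unbounded near
  \<open>0\<close>.
\<close>

section \<open>The fundamental theorem of calculus with countably many exceptions\<close>

text \<open>
  In the proof of the fundamental theorem, \<open>J\<close> absorbs the errors at the exceptional points: they are
  bounded by increments of \<open>J\<close>, which telescope over a tagged division, so that it need not be
  counted how often a point occurs as a tag. \<open>J\<close> is a sum of jumps of sizes \<open>2\<^sup>-\<^sup>n\<close>.
\<close>

lemma monotone_separator:
  fixes C :: "real set"
  assumes "countable C"
  obtains J :: "real \<Rightarrow> real" and \<eta> :: "real \<Rightarrow> real"
  where "mono J" "\<And>x. 0 \<le> J x" "\<And>x. J x \<le> 4" "\<And>c. 0 < \<eta> c"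
    "\<And>c u v. c \<in> C \<Longrightarrow> u \<le> c \<Longrightarrow> c \<le> v \<Longrightarrow> u < v \<Longrightarrow> \<eta> c \<le> J v - J u"
proof -
  define c where "c = from_nat_into (insert 0 C)"
  have C: "C \<subseteq> range c"
    unfolding c_def by (subst range_from_nat_into) (use assms in auto)
  \<comment> \<open>The two summands make \<open>J\<close> jump on both sides of \<open>c n\<close>, which may be either endpoint of \<open>[u,v]\<close>.\<close>
  define w where "w x n = (1/2)^n * (of_bool (c n < x) + of_bool (c n \<le> x) :: real)" for x n
  define J where "J x = suminf (w x)" for x
  have le: "0 \<le> w x n" "w x n \<le> 2 * (1/2)^n" for x n
    by (auto simp: w_def)
  have geo: "summable (\<lambda>n. 2 * (1/2)^n :: real)"
    by (intro summable_mult summable_geometric) simp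
  have sm: "summable (w x)" for x
    by (rule summable_comparison_test'[OF geo]) (use le in auto)
  have w_mono: "w u n \<le> w v n" if "u \<le> v" for u v n
    using that by (auto simp: w_def)
  have mono: "mono J"
    unfolding J_def by (intro monoI suminf_le w_mono sm)
  have J0: "0 \<le> J x" for x
    unfolding J_def by (intro suminf_nonneg sm le)
  have J4: "J x \<le> 4" for x
  proof -
    have "J x \<le> (\<Sum>n. 2 * (1/2)^n)"
      unfolding J_def by (intro suminf_le sm geo le)
    also have "\<dots> = 4"
      using suminf_geometric[of "1/2::real"] by (subst suminf_mult) (auto intro: summable_geometric)
    finally show ?thesis .
  qed
  \<comment> \<open>A point enumerated repeatedly is charged to its first index.\<close>
  define \<eta> where "\<eta> x = (1/2::real) ^ (LEAST n. c n = x)" for x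
  have "\<eta> x \<le> J v - J u" if "x \<in> C" "u \<le> x" "x \<le> v" "u < v" for x u v
  proof -
    define n where "n = (LEAST n. c n = x)"
    have cn: "c n = x"
      unfolding n_def using C that(1) by (metis (mono_tags, lifting) LeastI imageE subsetD)
    have "(1/2)^n \<le> w v n - w u n"
      using that cn by (auto simp: w_def)
    also have "\<dots> \<le> (\<Sum>k. w v k - w u k)"
      using sum_le_suminf[OF summable_diff[OF sm sm], of "{n}" v u] w_mono[of u v] that by simp
    also have "\<dots> = J v - J u"
      unfolding J_def by (intro suminf_diff[symmetric] sm)
    finally show ?thesis by (simp add: \<eta>_def n_def)
  qed
  with mono J0 J4 show thesis
    by (intro that[of J \<eta>]) (auto simp: \<eta>_def)
qed

text \<open>
  Outside \<open>C\<close> the gauge comes from differentiability, at points of \<open>C\<close> and at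
  the endpoints (where \<open>f\<close> may be replaced by \<open>0\<close>) from continuity.
  In both cases the error on \<open>[u,v]\<close> is at most the increment of
  \<open>G x = \<epsilon> (x + J x)\<close>, with \<open>J\<close> jumping at the exceptional points, and these increments telescope.
\<close>

lemma fundamental_theorem_of_calculus_countable:
  fixes F f :: "real \<Rightarrow> 'a::banach"
  assumes "a \<le> b" "countable C" and cont: "continuous_on {a..b} F"
    and deriv: "\<And>x. x \<in> {a<..<b} - C \<Longrightarrow> (F has_vector_derivative f x) (at x)"
  shows "(f has_integral F b - F a) {a..b}"
proof -
  define C' where "C' = insert a (insert b C)"
  have "countable C'" using assms by (simp add: C'_def)
  then obtain J \<eta> :: "real \<Rightarrow> real" where "mono J" and J: "\<And>x. 0 \<le> J x" "\<And>x. J x \<le> 4" and \<eta>: "\<And>c. 0 < \<eta> c"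
    and J_jump: "\<And>c u v. c \<in> C' \<Longrightarrow> u \<le> c \<Longrightarrow> c \<le> v \<Longrightarrow> u < v \<Longrightarrow> \<eta> c \<le> J v - J u"
    by (rule monotone_separator) blast
  define f' where "f' x = (if x \<in> C' then 0 else f x)" for x
  have "(f' has_integral F b - F a) {a..b}"
    unfolding has_integral_real
  proof (intro allI impI)
    fix e :: real
    assume "e > 0"
    \<comment> \<open>\<open>x + J x\<close> increases by at most \<open>b - a + 4\<close>; the extra unit makes the bound strict.\<close>
    define \<epsilon> where "\<epsilon> = e / (b - a + 5)"
    have "\<epsilon> > 0" using \<open>e > 0\<close> \<open>a \<le> b\<close> by (simp add: \<epsilon>_def)
    define G where "G x = \<epsilon> * (x + J x)" for x
    have "\<exists>d>0. \<forall>u v. x \<in> {u..v} \<longrightarrow> {u..v} \<subseteq> {a..b} \<longrightarrow> {u..v} \<subseteq> ball x d \<longrightarrow>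
            norm ((v - u) *\<^sub>R f' x - (F v - F u)) \<le> G v - G u" if x: "x \<in> {a..b}" for x
    proof (cases "x \<in> C'")
      case True
      have "0 < \<epsilon> * \<eta> x / 2" using \<open>\<epsilon> > 0\<close> \<eta> by simp
      with cont x obtain d where d: "d > 0"
        "\<And>y. y \<in> {a..b} \<Longrightarrow> dist y x < d \<Longrightarrow> dist (F y) (F x) < \<epsilon> * \<eta> x / 2"
        unfolding continuous_on_iff by metis
      have "norm ((v - u) *\<^sub>R f' x - (F v - F u)) \<le> G v - G u"
        if uv: "x \<in> {u..v}" "{u..v} \<subseteq> {a..b}" "{u..v} \<subseteq> ball x d" for u v
      proof (cases "u = v")
        case False
        have "u \<in> {u..v}" "v \<in> {u..v}" using uv(1) by auto
        then have "{u, v} \<subseteq> {a..b} \<inter> ball x d" using uv(2,3) by blast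
        then have *: "dist (F v) (F x) < \<epsilon> * \<eta> x / 2" "dist (F u) (F x) < \<epsilon> * \<eta> x / 2"
          using d(2)[of u] d(2)[of v] by (auto simp: dist_commute)
        have "norm (F v - F u) = dist (F v) (F u)" by (simp add: dist_norm)
        also have "\<dots> \<le> \<epsilon> * \<eta> x"
          using dist_triangle2[of "F v" "F u" "F x"] * by simp
        also have "\<dots> \<le> \<epsilon> * (J v - J u)"
          using J_jump[OF True, of u v] uv(1) False \<open>\<epsilon> > 0\<close> by simp
        also have "\<dots> \<le> G v - G u"
          using uv(1) \<open>\<epsilon> > 0\<close> by (simp add: G_def algebra_simps)
        finally show ?thesis using True by (simp add: f'_def norm_minus_commute)
      qed auto
      with d(1) show ?thesis by blast
    next
      case False
      then have "(F has_vector_derivative f' x) (at x)"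
        using deriv[of x] x by (auto simp: C'_def f'_def)
      then obtain d where d: "d > 0"
        "\<And>y. norm (y - x) < d \<Longrightarrow> norm (F y - F x - (y - x) *\<^sub>R f' x) \<le> \<epsilon> * norm (y - x)"
        using \<open>\<epsilon> > 0\<close> unfolding has_vector_derivative_def has_derivative_at_alt by blast
      have "norm ((v - u) *\<^sub>R f' x - (F v - F u)) \<le> G v - G u"
        if uv: "x \<in> {u..v}" "{u..v} \<subseteq> {a..b}" "{u..v} \<subseteq> ball x d" for u v
      proof -
        have "u \<in> {u..v}" "v \<in> {u..v}" using uv(1) by auto
        then have "u \<in> ball x d" "v \<in> ball x d" using uv(3) by blast+
        then have *: "norm (F u - F x - (u - x) *\<^sub>R f' x) \<le> \<epsilon> * norm (u - x)"
                  "norm (F v - F x - (v - x) *\<^sub>R f' x) \<le> \<epsilon> * norm (v - x)"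
          using d(2)[of u] d(2)[of v] by (auto simp: dist_real_def abs_minus_commute)
        have "(v - u) *\<^sub>R f' x - (F v - F u)
            = (F u - F x - (u - x) *\<^sub>R f' x) - (F v - F x - (v - x) *\<^sub>R f' x)"
          by (simp add: algebra_simps)
        also have "norm \<dots> \<le> \<epsilon> * norm (u - x) + \<epsilon> * norm (v - x)"
          by (rule order_trans[OF norm_triangle_ineq4 add_mono[OF *]])
        also have "\<dots> = \<epsilon> * (v - u)"
          using uv(1) by (simp add: algebra_simps)
        also have "\<dots> \<le> G v - G u"
          using monoD[OF \<open>mono J\<close>, of u v] uv(1) \<open>\<epsilon> > 0\<close> by (simp add: G_def algebra_simps)
        finally show ?thesis .
      qed
      with d(1) show ?thesis by blast
    qed
    then obtain d where d: "\<And>x. x \<in> {a..b} \<Longrightarrow> 0 < d x"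
      "\<And>x u v. x \<in> {a..b} \<Longrightarrow> x \<in> {u..v} \<Longrightarrow> {u..v} \<subseteq> {a..b} \<Longrightarrow> {u..v} \<subseteq> ball x (d x)
        \<Longrightarrow> norm ((v - u) *\<^sub>R f' x - (F v - F u)) \<le> G v - G u"
      by metis
    define \<gamma> where "\<gamma> x = (if x \<in> {a..b} then ball x (d x) else UNIV)" for x
    have "gauge \<gamma>"
      using d(1) by (auto simp: gauge_def \<gamma>_def)
    moreover have "norm ((\<Sum>(x, K)\<in>p. measure lborel K *\<^sub>R f' x) - (F b - F a)) < e"
      if p: "p tagged_division_of {a..b}" "\<gamma> fine p" for p
    proof -
      have "(\<Sum>(x, K)\<in>p. measure lborel K *\<^sub>R f' x) - (F b - F a)
          = (\<Sum>(x, K)\<in>p. measure lborel K *\<^sub>R f' x - (F (Sup K) - F (Inf K)))"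
        unfolding additive_tagged_division_1[OF \<open>a \<le> b\<close> p(1), of F, symmetric]
        by (simp add: split_def sum_subtractf)
      also have "norm \<dots> \<le> (\<Sum>(x, K)\<in>p. G (Sup K) - G (Inf K))"
        unfolding split_def
      proof (rule sum_norm_le)
        fix q assume q: "q \<in> p"
        obtain x K where xK: "q = (x, K)" by force
        have K: "x \<in> K" "K \<subseteq> {a..b}" "\<exists>u v. K = cbox u v"
          using tagged_division_ofD(2-4)[OF p(1)] q xK by blast+
        then obtain u v where uv: "K = {u..v}" by auto
        have "x \<in> {a..b}" using K by blast
        then have "K \<subseteq> ball x (d x)"
          using fineD[OF p(2) q[unfolded xK]] by (simp add: \<gamma>_def)
        with K uv have "norm ((v - u) *\<^sub>R f' x - (F v - F u)) \<le> G v - G u"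
          by (intro d(2)) auto
        moreover have "u \<le> v" using K(1) uv by simp
        ultimately show "norm (measure lborel (snd q) *\<^sub>R f' (fst q) - (F (Sup (snd q)) - F (Inf (snd q))))
            \<le> G (Sup (snd q)) - G (Inf (snd q))"
          using uv xK by simp
      qed
      also have "\<dots> = G b - G a"
        by (rule additive_tagged_division_1[OF \<open>a \<le> b\<close> p(1)])
      also have "\<dots> \<le> \<epsilon> * (b - a + 4)"
        unfolding G_def right_diff_distrib[symmetric]
        using J(1)[of a] J(2)[of b] \<open>\<epsilon> > 0\<close> by (intro mult_left_mono) auto
      also have "\<dots> < \<epsilon> * (b - a + 5)" using \<open>\<epsilon> > 0\<close> by simp
      also have "\<dots> = e" using \<open>a \<le> b\<close> by (simp add: \<epsilon>_def)
      finally show ?thesis .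
    qed
    ultimately show "\<exists>\<gamma>. gauge \<gamma> \<and> (\<forall>\<D>. \<D> tagged_division_of {a..b} \<and> \<gamma> fine \<D> \<longrightarrow>
        norm ((\<Sum>(x, k)\<in>\<D>. measure lborel k *\<^sub>R f' x) - (F b - F a)) < e)"
      by (intro exI[of _ \<gamma>]) auto
  qed
  moreover have "negligible C'"
    using \<open>countable C'\<close> by (simp add: negligible_iff_null_sets countable_imp_null_set_lborel null_sets_completionI)
  ultimately show ?thesis
    by (auto intro: has_integral_spike[of C' _ f f'] simp: f'_def)
qed

section \<open>Compact time scales and their gaps\<close>

definition ts_floor :: "real set \<Rightarrow> real \<Rightarrow> real" where
  "ts_floor K x = Sup {s \<in> K. s \<le> x}"

locale compact_time_scale =
  fixes K :: "real set" and a b :: real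
  assumes closed_K: "closed K" and a_in: "a \<in> K" and b_in: "b \<in> K" and K_sub: "K \<subseteq> {a..b}"
begin

lemma a_le_b: "a \<le> b"
  using a_in K_sub by auto

lemma floor_props:
  assumes "a \<le> x"
  shows floor_in: "ts_floor K x \<in> K" and floor_le: "ts_floor K x \<le> x"
    and le_floor: "\<And>s. s \<in> K \<Longrightarrow> s \<le> x \<Longrightarrow> s \<le> ts_floor K x"
proof -
  let ?S = "{s \<in> K. s \<le> x}"
  have S: "?S \<noteq> {}" "bdd_above ?S" using assms a_in by (auto intro: bdd_aboveI)
  have "?S = K \<inter> {..x}" by auto
  then have "closed ?S" using closed_K by (simp add: closed_Int)
  then have "Sup ?S \<in> ?S" using S by (intro closed_contains_Sup)
  then show "ts_floor K x \<in> K" "ts_floor K x \<le> x" by (auto simp: ts_floor_def)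
  show "s \<le> ts_floor K x" if "s \<in> K" "s \<le> x" for s
    unfolding ts_floor_def using S that by (intro cSup_upper) auto
qed

lemma floor_id: "t \<in> K \<Longrightarrow> ts_floor K t = t"
  using K_sub by (intro antisym floor_le le_floor) auto

lemma floor_eqI:
  assumes "t \<in> K" "t \<le> x" "\<And>s. s \<in> K \<Longrightarrow> s \<le> x \<Longrightarrow> s \<le> t"
  shows "ts_floor K x = t"
  using assms K_sub by (intro antisym assms floor_in floor_le le_floor) auto

lemma floor_mono: "a \<le> x \<Longrightarrow> x \<le> y \<Longrightarrow> ts_floor K x \<le> ts_floor K y"
  by (meson floor_in floor_le le_floor order_trans)

lemma jump_props:
  assumes "t \<in> K" "t < b"
  shows jump_in: "fwd_jump K t \<in> K" and jump_ge: "t \<le> fwd_jump K t"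
    and jump_le: "\<And>s. s \<in> K \<Longrightarrow> t < s \<Longrightarrow> fwd_jump K t \<le> s"
proof -
  let ?S = "{s \<in> K. t < s}"
  have S: "?S \<noteq> {}" "bdd_below ?S" using assms b_in by (auto intro: bdd_belowI[of _ t])
  have eq: "fwd_jump K t = Inf ?S" using assms b_in by (auto simp: fwd_jump_def)
  have "Inf ?S \<in> closure ?S" using S by (intro closure_contains_Inf)
  also have "\<dots> \<subseteq> K" using closed_K by (intro closure_minimal) auto
  finally show "fwd_jump K t \<in> K" by (simp add: eq)
  show "t \<le> fwd_jump K t" unfolding eq using S by (intro cInf_greatest) auto
  show "fwd_jump K t \<le> s" if "s \<in> K" "t < s" for s
    unfolding eq using S that by (intro cInf_lower) auto
qed

lemma right_scatteredD:
  assumes "right_scattered K t"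
  shows "t \<in> K" "t < b" "t < fwd_jump K t"
proof -
  show t: "t \<in> K" "t < fwd_jump K t" using assms by (auto simp: right_scattered_def)
  then have "\<exists>s\<in>K. t < s" by (auto simp: fwd_jump_def split: if_splits)
  then show "t < b" using K_sub by force
qed

text \<open>
  Hence all points of \<open>K\<close> other than \<open>b\<close> and the countably many right-scattered ones are
  right-dense.
\<close>

lemma right_dense_iff:
  "right_dense K t \<longleftrightarrow> t \<in> K \<and> t < b \<and> \<not> right_scattered K t"
proof
  assume "right_dense K t"
  then show "t \<in> K \<and> t < b \<and> \<not> right_scattered K t"
    using K_sub by (force simp: right_dense_def right_scattered_def)
next
  assume "t \<in> K \<and> t < b \<and> \<not> right_scattered K t"
  then show "right_dense K t"
    using jump_ge[of t] b_in by (force simp: right_dense_def right_scattered_def)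
qed

lemma right_dense_approx:
  assumes "right_dense K t" "t < x"
  obtains u where "u \<in> K" "t < u" "u < x"
proof -
  have *: "{s \<in> K. t < s} \<noteq> {}" "Inf {s \<in> K. t < s} = t"
    using assms by (auto simp: right_dense_def fwd_jump_def split: if_splits)
  then obtain u where "u \<in> {s \<in> K. t < s}" "u < x"
    using assms(2) cInf_lessD[of "{s \<in> K. t < s}" x] by auto
  then show thesis using that by auto
qed

lemma gap:
  assumes "x \<in> {a..b}" "x \<notin> K"
  defines "l \<equiv> ts_floor K x"
  shows gap_scattered: "right_scattered K l" and gap_less: "l < x" "x < fwd_jump K l"
proof -
  have l: "l \<in> K" "l \<le> x" using assms floor_in floor_le by auto
  with assms(2) show "l < x" by (metis order_le_less)
  with assms(1) have "l < b" by auto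
  note j = jump_in[OF l(1) this] jump_ge[OF l(1) this]
  have b_j: "\<And>s. s \<in> K \<Longrightarrow> l < s \<Longrightarrow> x < s"
    using le_floor[of x] assms by (metis atLeastAtMost_iff not_le)
  have "l \<noteq> fwd_jump K l"
  proof
    assume eq: "l = fwd_jump K l"
    then have "right_dense K l" using l \<open>l < b\<close> by (auto simp: right_dense_iff right_scattered_def)
    then show False using right_dense_approx[OF _ \<open>l < x\<close>] b_j by (metis less_asym)
  qed
  with j l show "right_scattered K l" "x < fwd_jump K l" by (auto simp: right_scattered_def b_j)
qed

lemma floor_in_gap:
  assumes "right_scattered K l" "l \<le> x" "x < fwd_jump K l"
  shows "ts_floor K x = l"
  using right_scatteredD[OF assms(1)] assms(2,3)
  by (intro floor_eqI) (meson jump_le not_le order_trans order_less_le_trans less_irrefl)+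

text \<open>
  The gaps \<open>(t, \<sigma>(t))\<close> after right-scattered points are disjoint nonempty open intervals.
\<close>

lemma countable_right_scattered: "countable {t. right_scattered K t}"
proof -
  let ?I = "\<lambda>t. {t<..<fwd_jump K t}"
  have disj: "disjnt (?I s) (?I t)" if "right_scattered K s" "right_scattered K t" "s < t" for s t
    using jump_le[of s t] right_scatteredD that by (force simp: disjnt_def)
  then have disj': "disjnt (?I s) (?I t)" if "right_scattered K s" "right_scattered K t" "s \<noteq> t" for s t
    using that by (metis disjnt_sym linorder_neqE_linordered_idom)
  then have "pairwise disjnt (?I ` {t. right_scattered K t})"
    by (intro pairwise_imageI) auto
  then have "countable (?I ` {t. right_scattered K t})"
    by (intro countable_disjoint_open_subsets) auto
  moreover have "inj_on ?I {t. right_scattered K t}"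
  proof (rule inj_onI, rule ccontr)
    fix s t assume st: "s \<in> {t. right_scattered K t}" "t \<in> {t. right_scattered K t}" "?I s = ?I t" "s \<noteq> t"
    then have "disjnt (?I s) (?I t)" using disj' by blast
    then have "?I s = {}" using st(3) by (simp add: disjnt_def)
    then show False using st(1) right_scatteredD(3) dense by fastforce
  qed
  ultimately show ?thesis by (rule countable_image_inj_on)
qed

text \<open>
  The points approximated from the left are described through right-scattered ones: a point
  \<open>t > a\<close> without this property ends a gap, so that \<open>t = \<sigma>(s)\<close> with \<open>s\<close> right-scattered. There
  are only countably many of these.
\<close>

lemma left_approx:
  assumes t: "t \<in> K" "a < t" "t \<notin> fwd_jump K ` {s. right_scattered K s}" and "x < t"
  obtains u where "u \<in> K" "x < u" "u < t"
proof (rule ccontr)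
  assume "\<not> thesis"
  with that have none: "\<And>u. u \<in> K \<Longrightarrow> x < u \<Longrightarrow> u < t \<Longrightarrow> False" by blast
  obtain y where y: "max a x < y" "y < t" using dense[of "max a x" t] assms by auto
  have "t \<le> b" using t K_sub by auto
  have "y \<notin> K" using y none by auto
  let ?l = "ts_floor K y"
  have g: "right_scattered K ?l" "?l < y" "y < fwd_jump K ?l"
    using gap[of y] y \<open>y \<notin> K\<close> \<open>t \<le> b\<close> by auto
  have "fwd_jump K ?l \<le> t"
    using jump_le[of ?l t] right_scatteredD[OF g(1)] g y t(1) by auto
  moreover have "\<not> fwd_jump K ?l < t"
    using none[of "fwd_jump K ?l"] g y jump_in[of ?l] right_scatteredD[OF g(1)] by auto
  ultimately show False using t(3) g(1) by auto
qed

end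

section \<open>Pre-antiderivatives as Henstock-Kurzweil integrals\<close>

context compact_time_scale
begin

lemma pre_antiderivative_jump:
  assumes "pre_antiderivative K f F" "right_scattered K t"
  shows "F (fwd_jump K t) = F t + f t * (fwd_jump K t - t)"
proof -
  note t = right_scatteredD[OF assms(2)]
  then have "t \<in> ts_kappa K" using b_in by (force simp: ts_kappa_def)
  then have "has_delta_derivative K F (f t) t"
    using assms by (auto simp: pre_antiderivative_def)
  then have *: "\<bar>F (fwd_jump K t) - F t - f t * (fwd_jump K t - t)\<bar> \<le> \<epsilon> * \<bar>fwd_jump K t - t\<bar>"
    if "\<epsilon> > 0" for \<epsilon>
    using that t(1) unfolding has_delta_derivative_def by force
  have "\<bar>F (fwd_jump K t) - F t - f t * (fwd_jump K t - t)\<bar> \<le> 0 + e" if "e > 0" for e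
    using *[of "e / \<bar>fwd_jump K t - t\<bar>"] that t(3) by simp
  then have "\<bar>F (fwd_jump K t) - F t - f t * (fwd_jump K t - t)\<bar> \<le> 0"
    by (rule field_le_epsilon)
  then show ?thesis by simp
qed

end

text \<open>
  When \<open>F\<close> has delta derivative \<open>f\<close> at right-scattered points, this is the piecewise linear
  interpolation of \<open>F\<close>: on the gap after \<open>l\<close> its slope \<open>f l\<close> is the difference quotient of \<open>F\<close>.
\<close>

definition ts_interpolate :: "real set \<Rightarrow> (real \<Rightarrow> real) \<Rightarrow> (real \<Rightarrow> real) \<Rightarrow> real \<Rightarrow> real" where
  "ts_interpolate K f F x = F (ts_floor K x) + f (ts_floor K x) * (x - ts_floor K x)"

locale interpolation = compact_time_scale +
  fixes f F :: "real \<Rightarrow> real"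
  assumes jump: "right_scattered K l \<Longrightarrow> F (fwd_jump K l) = F l + f l * (fwd_jump K l - l)"
begin

abbreviation "I \<equiv> ts_interpolate K f F"

lemma interpolate_id: "t \<in> K \<Longrightarrow> I t = F t"
  by (simp add: ts_interpolate_def floor_id)

lemma interpolate_gap:
  assumes "right_scattered K l" "l \<le> x" "x \<le> fwd_jump K l"
  shows "I x = F l + f l * (x - l)"
proof (cases "x = fwd_jump K l")
  case True
  then show ?thesis
    using jump[OF assms(1)] right_scatteredD[OF assms(1)] by (simp add: interpolate_id jump_in)
next
  case False
  then have "ts_floor K x = l" using assms floor_in_gap by auto
  then show ?thesis by (simp add: ts_interpolate_def)
qed

text \<open>
  On a gap an affine function lies above the affine interpolant if it does so at both ends.
\<close>

lemma interpolate_le_affine: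
  assumes "u \<in> K" "v \<in> K" "x \<in> {u..v}"
    and le: "\<And>s. s \<in> K \<Longrightarrow> s \<in> {u..v} \<Longrightarrow> F s \<le> p + q * s"
  shows "I x \<le> p + q * x"
proof (cases "x \<in> K")
  case True
  then show ?thesis using le assms by (simp add: interpolate_id)
next
  case False
  have x: "x \<in> {a..b}" using assms K_sub by auto
  define l where "l = ts_floor K x"
  define r where "r = fwd_jump K l"
  have l: "right_scattered K l" "l < x" "x < r"
    using gap[OF x False] by (auto simp: l_def r_def)
  note l' = right_scatteredD[OF l(1)]
  have "u \<le> l" using le_floor[of x u] x assms(1,3) by (simp add: l_def)
  moreover have "r \<le> v" using jump_le[of l v] l l' assms(2,3) by (simp add: r_def)
  moreover have "r \<in> K" using jump_in[of l] l' by (simp add: r_def)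
  ultimately have lr: "l \<in> {u..v}" "r \<in> {u..v}" "r \<in> K" using l by auto
  have "F l \<le> p + q * l" "F r \<le> p + q * r" using lr l' le by auto
  moreover have "F r = F l + f l * (r - l)" using jump[OF l(1)] by (simp add: r_def)
  moreover have "I x = F l + f l * (x - l)"
    using interpolate_gap[OF l(1), of x] l by (simp add: r_def)
  moreover have "(f l - q) * (x - l) \<le> (f l - q) * (r - l) \<or> (f l - q) * (x - l) \<le> 0"
  proof (cases "f l \<ge> q")
    case True
    then show ?thesis using l by (intro disjI1 mult_left_mono) auto
  next
    case False
    then show ?thesis using l by (intro disjI2 mult_nonpos_nonneg) auto
  qed
  ultimately show ?thesis unfolding right_diff_distrib left_diff_distrib by linarith
qed

text \<open>
  The transfer principle for continuity and differentiability: estimates of \<open>F\<close> by affine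
  functions carry over from \<open>K\<close> to \<open>[u,v]\<close>. The error bound is itself affine, which covers both a
  constant \<open>\<epsilon>\<close> and the bound \<open>\<epsilon> \<bar>x - t\<bar>\<close> on either side of a point \<open>t\<close>.
\<close>

lemma interpolate_near_affine:
  assumes "u \<in> K" "v \<in> K" "x \<in> {u..v}"
    and le: "\<And>s. s \<in> K \<Longrightarrow> s \<in> {u..v} \<Longrightarrow> \<bar>F s - (p + q * s)\<bar> \<le> p' + q' * s"
  shows "\<bar>I x - (p + q * x)\<bar> \<le> p' + q' * x"
proof -
  interpret neg: interpolation K a b "\<lambda>t. - f t" "\<lambda>t. - F t"
    by unfold_locales (simp add: jump)
  have "I x \<le> (p + p') + (q + q') * x"
    using assms(1-3) by (rule interpolate_le_affine) (use le in \<open>force simp: algebra_simps abs_le_iff\<close>)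
  moreover have "neg.I x \<le> (p' - p) + (q' - q) * x"
    using assms(1-3) by (rule neg.interpolate_le_affine) (use le in \<open>force simp: algebra_simps abs_le_iff\<close>)
  moreover have "neg.I x = - I x" by (simp add: ts_interpolate_def)
  ultimately show ?thesis by (simp add: abs_le_iff algebra_simps)
qed

text \<open>
  Either points of \<open>K\<close> approach \<open>x\<close> from the right, and closeness of the values of \<open>F\<close> is
  transferred to the interpolant, or a gap extends to the right of \<open>x\<close>, where the interpolant is affine.
\<close>

lemma interpolate_at_right:
  assumes cont: "continuous_on K F" and x: "a \<le> x" "x < b"
  shows "(I \<longlongrightarrow> I x) (at_right x)"
proof (cases "right_dense K x")
  case True
  then have "x \<in> K" by (simp add: right_dense_def)
  show ?thesis
  proof (rule tendstoI)
    fix e :: real assume "e > 0"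
    then obtain d where d: "d > 0" "\<And>s. s \<in> K \<Longrightarrow> dist s x < d \<Longrightarrow> dist (F s) (F x) < e / 2"
      using cont \<open>x \<in> K\<close> unfolding continuous_on_iff by (metis half_gt_zero)
    obtain u where u: "u \<in> K" "x < u" "u < x + d"
      using right_dense_approx[OF True, of "x + d"] d(1) by auto
    have "dist (I y) (I x) < e" if "x < y" "y < u" for y
    proof -
      have "\<bar>F s - (F x + 0 * s)\<bar> \<le> e / 2 + 0 * s" if "s \<in> K" "s \<in> {x..u}" for s
        using d(2)[of s] that u by (auto simp: dist_real_def)
      from interpolate_near_affine[OF \<open>x \<in> K\<close> u(1) _ this, of y] that
      show ?thesis using \<open>e > 0\<close> \<open>x \<in> K\<close> by (simp add: dist_real_def interpolate_id)
    qed
    then show "\<forall>\<^sub>F y in at_right x. dist (I y) (I x) < e"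
      using u(2) eventually_at_right_field by blast
  qed
next
  case False
  define l where "l = ts_floor K x"
  have l: "right_scattered K l" "l \<le> x" "x < fwd_jump K l"
  proof (atomize(full), cases "x \<in> K")
    case True
    then have "right_scattered K x" "l = x"
      using False x by (auto simp: right_dense_iff l_def floor_id)
    then show "right_scattered K l \<and> l \<le> x \<and> x < fwd_jump K l"
      using right_scatteredD by auto
  qed (use gap[of x] x in \<open>auto simp: l_def\<close>)
  have "((\<lambda>y. F l + f l * (y - l)) \<longlongrightarrow> F l + f l * (x - l)) (at_right x)"
    by (intro tendsto_intros)
  moreover have "\<forall>\<^sub>F y in at_right x. F l + f l * (y - l) = I y"
    unfolding eventually_at_right_field
    using interpolate_gap[OF l(1)] l by (intro exI[of _ "fwd_jump K l"]) auto
  ultimately have "(I \<longlongrightarrow> F l + f l * (x - l)) (at_right x)"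
    by (rule Lim_transform_eventually)
  then show ?thesis
    using interpolate_gap[OF l(1), of x] l by simp
qed

lemma interpolate_at_left:
  assumes cont: "continuous_on K F" and x: "a < x" "x \<le> b"
  shows "(I \<longlongrightarrow> I x) (at_left x)"
proof (cases "x \<in> K - fwd_jump K ` {s. right_scattered K s}")
  case True
  show ?thesis
  proof (rule tendstoI)
    fix e :: real assume "e > 0"
    then obtain d where d: "d > 0" "\<And>s. s \<in> K \<Longrightarrow> dist s x < d \<Longrightarrow> dist (F s) (F x) < e / 2"
      using cont True unfolding continuous_on_iff by (metis half_gt_zero DiffD1)
    obtain u where u: "u \<in> K" "x - d < u" "u < x"
      using left_approx[of x "x - d"] d(1) True x by auto
    have "dist (I y) (I x) < e" if "u < y" "y < x" for y
    proof -
      have "\<bar>F s - (F x + 0 * s)\<bar> \<le> e / 2 + 0 * s" if "s \<in> K" "s \<in> {u..x}" for s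
        using d(2)[of s] that u by (auto simp: dist_real_def)
      from interpolate_near_affine[OF u(1) _ _ this, of x y] that
      show ?thesis using \<open>e > 0\<close> True by (simp add: dist_real_def interpolate_id)
    qed
    then show "\<forall>\<^sub>F y in at_left x. dist (I y) (I x) < e"
      using u(3) eventually_at_left_field by blast
  qed
next
  case False
  have "\<exists>l. right_scattered K l \<and> l < x \<and> x \<le> fwd_jump K l"
  proof (cases "x \<in> K")
    case True
    then show ?thesis using False right_scatteredD by fastforce
  next
    case False
    then show ?thesis using gap[of x] x by (auto intro!: exI[of _ "ts_floor K x"])
  qed
  then obtain l where l: "right_scattered K l" "l < x" "x \<le> fwd_jump K l" by blast
  have "((\<lambda>y. F l + f l * (y - l)) \<longlongrightarrow> F l + f l * (x - l)) (at_left x)"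
    by (intro tendsto_intros)
  moreover have "\<forall>\<^sub>F y in at_left x. F l + f l * (y - l) = I y"
    unfolding eventually_at_left_field
    using interpolate_gap[OF l(1)] l by (intro exI[of _ l]) auto
  ultimately have "(I \<longlongrightarrow> F l + f l * (x - l)) (at_left x)"
    by (rule Lim_transform_eventually)
  then show ?thesis
    using interpolate_gap[OF l(1), of x] l by simp
qed

lemma continuous_on_interpolate:
  assumes "continuous_on K F"
  shows "continuous_on {a..b} I"
proof (cases "a < b")
  case True
  then show ?thesis
  proof (rule continuous_on_IccI[rotated 3])
    show "(I \<longlongrightarrow> I a) (at_right a)" using True by (intro interpolate_at_right assms) auto
    show "(I \<longlongrightarrow> I b) (at_left b)" using True by (intro interpolate_at_left assms) auto
    show "I \<midarrow>x\<rightarrow> I x" if "a < x" "x < b" for x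
      using interpolate_at_left[OF assms, of x] interpolate_at_right[OF assms, of x] that
      by (intro filterlim_split_at) simp_all
  qed
next
  case False
  then have "a = b" using a_le_b by simp
  then show ?thesis by simp
qed

text \<open>
  Points of \<open>K\<close> on both sides of \<open>t\<close> and arbitrarily near to it are needed here: if \<open>t\<close> ended a gap, the
  left derivative would be the slope on that gap, which has nothing to do with \<open>c\<close>.
\<close>

lemma interpolate_derivative_dense:
  assumes D: "has_delta_derivative K F c t" and t: "right_dense K t"
    "a < t" "t \<notin> fwd_jump K ` {s. right_scattered K s}"
  shows "(I has_vector_derivative c) (at t)"
  unfolding has_vector_derivative_def has_derivative_at_alt
proof (intro conjI allI impI bounded_linear_scaleR_left)
  fix e :: real assume "e > 0"
  have "t \<in> K" "fwd_jump K t = t" using t(1) by (auto simp: right_dense_def)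
  then obtain d where d: "d > 0"
    "\<And>s. s \<in> K \<Longrightarrow> \<bar>s - t\<bar> < d \<Longrightarrow> \<bar>F t - F s - c * (t - s)\<bar> \<le> e * \<bar>t - s\<bar>"
    using D \<open>e > 0\<close> unfolding has_delta_derivative_def by metis
  obtain u where u: "u \<in> K" "t < u" "u < t + d"
    using right_dense_approx[OF t(1), of "t + d"] d(1) by auto
  obtain l where l: "l \<in> K" "t - d < l" "l < t"
    using left_approx[OF \<open>t \<in> K\<close> t(2,3), of "t - d"] d(1) by auto
  have "norm (I y - I t - (y - t) *\<^sub>R c) \<le> e * norm (y - t)" if "l < y" "y < u" for y
  proof (cases "y \<ge> t")
    case True
    have "\<bar>F s - ((F t - c * t) + c * s)\<bar> \<le> - e * t + e * s" if "s \<in> K" "s \<in> {t..u}" for s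
    proof -
      have "\<bar>F t - F s - c * (t - s)\<bar> \<le> e * (s - t)"
        using d(2)[of s] that u by (simp add: abs_of_nonpos)
      then show ?thesis by (simp add: abs_le_iff algebra_simps)
    qed
    from interpolate_near_affine[OF \<open>t \<in> K\<close> u(1) _ this, of y] that True
    show ?thesis by (simp add: interpolate_id[OF \<open>t \<in> K\<close>] algebra_simps)
  next
    case False
    have "\<bar>F s - ((F t - c * t) + c * s)\<bar> \<le> e * t + (- e) * s" if "s \<in> K" "s \<in> {l..t}" for s
    proof -
      have "\<bar>F t - F s - c * (t - s)\<bar> \<le> e * (t - s)"
        using d(2)[of s] that l by (simp add: abs_of_nonpos)
      then show ?thesis by (simp add: abs_le_iff algebra_simps)
    qed
    from interpolate_near_affine[OF l(1) \<open>t \<in> K\<close> _ this, of y] that False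
    show ?thesis by (simp add: interpolate_id[OF \<open>t \<in> K\<close>] algebra_simps)
  qed
  then show "\<exists>d>0. \<forall>y. norm (y - t) < d \<longrightarrow> norm (I y - I t - (y - t) *\<^sub>R c) \<le> e * norm (y - t)"
    using u(2) l(3) by (intro exI[of _ "min (u - t) (t - l)"]) auto
qed

lemma interpolate_derivative_gap:
  assumes "x \<in> {a..b}" "x \<notin> K"
  shows "(I has_vector_derivative f (ts_floor K x)) (at x)"
proof -
  let ?l = "ts_floor K x"
  have "((\<lambda>y. F ?l + f ?l * (y - ?l)) has_vector_derivative f ?l) (at x)"
    by (auto intro!: derivative_eq_intros)
  then show ?thesis
    by (rule has_vector_derivative_transform_within_open[of _ _ _ "{?l<..<fwd_jump K ?l}"])
      (use gap[OF assms] interpolate_gap[of ?l] in auto)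
qed

end

context compact_time_scale
begin

text \<open>
  The interpolant of \<open>F\<close> can fail to have the step extension of \<open>f\<close> as derivative only at
  the ends of gaps and at the points exempted in the definition of a pre-antiderivative.
  As the value of an integral is unique, \<open>F b - F a\<close> is the same for all
  pre-antiderivatives.
\<close>

theorem pre_antiderivative_has_integral:
  assumes "pre_antiderivative K f F"
  shows "((\<lambda>x. f (ts_floor K x)) has_integral F b - F a) {a..b}"
proof -
  interpret interpolation K a b f F
    by unfold_locales (rule pre_antiderivative_jump[OF assms])
  from assms obtain D where cont: "continuous_on K F" and D: "countable (ts_kappa K - D)"
    "\<And>t. t \<in> D \<Longrightarrow> has_delta_derivative K F (f t) t"
    by (auto simp: pre_antiderivative_def)
  let ?C = "{s. right_scattered K s} \<union> fwd_jump K ` {s. right_scattered K s} \<union> (ts_kappa K - D)"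
  have "((\<lambda>x. f (ts_floor K x)) has_integral I b - I a) {a..b}"
  proof (rule fundamental_theorem_of_calculus_countable[OF a_le_b])
    show "countable ?C"
      using countable_right_scattered D(1) by (intro countable_Un countable_image)
    show "continuous_on {a..b} I"
      by (rule continuous_on_interpolate[OF cont])
    fix x assume x: "x \<in> {a<..<b} - ?C"
    show "(I has_vector_derivative f (ts_floor K x)) (at x)"
    proof (cases "x \<in> K")
      case True
      have "\<not> (\<forall>s\<in>K. s \<le> x)" using x b_in by fastforce
      with True have "x \<in> ts_kappa K" by (simp add: ts_kappa_def)
      with x have "x \<in> D" by blast
      moreover have "right_dense K x" using x True by (simp add: right_dense_iff)
      ultimately show ?thesis
        using x interpolate_derivative_dense[OF D(2), of x] by (simp add: floor_id[OF True])
    next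
      case False
      with x show ?thesis by (intro interpolate_derivative_gap) auto
    qed
  qed
  then show ?thesis by (simp add: interpolate_id a_in b_in)
qed

end

section \<open>Indefinite integrals as pre-antiderivatives\<close>

context compact_time_scale
begin

text \<open>
  The bound on \<open>f\<close> is required on \<open>[u,v)\<close> only, since the step extension evaluates
  \<open>f\<close> at \<open>v\<close> in no other point of \<open>[u,v]\<close> than \<open>v\<close>.
  Thus the case where \<open>v\<close> is the forward jump of \<open>u\<close> is included with \<open>B = 0\<close>.
\<close>

lemma floor_step_integral_bound:
  assumes int: "(\<lambda>x. f (ts_floor K x)) integrable_on {a..b}"
    and "u \<in> K" "v \<in> K" "u \<le> v" "0 \<le> B"
    and bound: "\<And>s. s \<in> K \<Longrightarrow> u \<le> s \<Longrightarrow> s < v \<Longrightarrow> \<bar>f s - c\<bar> \<le> B"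
  shows "\<bar>integral {a..v} (\<lambda>x. f (ts_floor K x)) - integral {a..u} (\<lambda>x. f (ts_floor K x)) - c * (v - u)\<bar>
           \<le> B * (v - u)"
proof -
  let ?g = "\<lambda>x. f (ts_floor K x)"
  have uv: "a \<le> u" "v \<le> b" using assms K_sub by auto
  have ints: "?g integrable_on {a..v}" "?g integrable_on {u..v}"
    using uv assms(4) by (auto intro: integrable_on_subinterval[OF int])
  have "((\<lambda>x. ?g x - c) has_integral integral {u..v} ?g - (v - u) * c) {u..v}"
    using has_integral_diff[OF integrable_integral[OF ints(2)] has_integral_const_real[of c u v]] assms(4)
    by simp
  moreover have "norm (?g x - c) \<le> B" if "x \<in> cbox u v - {v}" for x
  proof -
    have x: "a \<le> x" "u \<le> x" "x < v" using that uv by auto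
    have "ts_floor K x < v" using floor_le[OF x(1)] x(3) by simp
    then show ?thesis
      using bound[OF floor_in[OF x(1)] le_floor[OF x(1) assms(2) x(2)]] by simp
  qed
  ultimately have "norm (integral {u..v} ?g - (v - u) * c) \<le> B * measure lborel (cbox u v)"
    using \<open>0 \<le> B\<close> by (intro has_integral_bound_spike_finite[of B "{v}"]) auto
  moreover have "integral {a..u} ?g + integral {u..v} ?g = integral {a..v} ?g"
    using Henstock_Kurzweil_Integration.integral_combine[OF uv(1) assms(4) ints(1)] .
  ultimately show ?thesis using assms(4) by (simp add: algebra_simps)
qed

text \<open>
  At a right-scattered point the derivative is correct because the step extension is constant on the gap. At
  a right-dense point continuity of \<open>f\<close> within \<open>K\<close> suffices, also if the point ends a gap, since only
  increments between points of \<open>K\<close> matter. The maximum \<open>b\<close>, being neither, is exempted together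
  with \<open>E\<close>.
\<close>

theorem pre_antiderivative_integral:
  assumes int: "(\<lambda>x. f (ts_floor K x)) integrable_on {a..b}"
    and E: "countable E"
    and cont: "\<And>t. right_dense K t \<Longrightarrow> t \<notin> E \<Longrightarrow> continuous (at t within K) f"
  shows "pre_antiderivative K f (\<lambda>t. integral {a..t} (\<lambda>x. f (ts_floor K x)))"
    (is "pre_antiderivative K f ?G")
proof -
  define D where "D = {t. right_scattered K t} \<union> ({t. right_dense K t} - E)"
  have contG: "continuous_on K ?G"
    using indefinite_integral_continuous_1[OF int] K_sub by (rule continuous_on_subset)
  have "D \<subseteq> ts_kappa K"
  proof
    fix t assume "t \<in> D"
    then have "t \<in> K" "t < b" using right_scatteredD by (auto simp: D_def right_dense_iff)
    moreover from this have "\<not> (\<forall>s\<in>K. s \<le> t)" using b_in by fastforce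
    ultimately show "t \<in> ts_kappa K" by (simp add: ts_kappa_def)
  qed
  moreover have sub: "ts_kappa K - D \<subseteq> E \<union> {b}"
    using K_sub by (force simp: ts_kappa_def D_def right_dense_iff)
  then have "countable (ts_kappa K - D)"
    by (rule countable_subset) (simp add: E)
  moreover have "has_delta_derivative K ?G (f t) t" if "t \<in> D" for t
    unfolding has_delta_derivative_def
  proof (intro allI impI)
    fix \<epsilon> :: real assume "\<epsilon> > 0"
    let ?\<sigma> = "fwd_jump K t"
    show "\<exists>\<delta>>0. \<forall>s\<in>K. \<bar>s - t\<bar> < \<delta> \<longrightarrow> \<bar>?G ?\<sigma> - ?G s - f t * (?\<sigma> - s)\<bar> \<le> \<epsilon> * \<bar>?\<sigma> - s\<bar>"
    proof (cases "right_scattered K t")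
      case True
      note t = right_scatteredD[OF True]
      let ?m = "?\<sigma> - t"
      have "\<bar>?G ?\<sigma> - ?G t - f t * ?m\<bar> \<le> 0 * ?m"
      proof (rule floor_step_integral_bound[OF int t(1) jump_in[OF t(1,2)]])
        show "\<bar>f s - f t\<bar> \<le> 0" if "s \<in> K" "t \<le> s" "s < ?\<sigma>" for s
        proof -
          have "s = t" using jump_le[OF t(1,2), of s] that by force
          then show ?thesis by simp
        qed
      qed (use t in auto)
      then have jumpG: "?G ?\<sigma> - ?G t = f t * ?m" by simp
      have "continuous_on K (\<lambda>s. ?G s - f t * s)"
        by (intro continuous_intros contG)
      moreover have "0 < \<epsilon> * ?m / 2" using \<open>\<epsilon> > 0\<close> t by simp
      ultimately obtain d where d: "d > 0"
        "\<And>s. s \<in> K \<Longrightarrow> dist s t < d \<Longrightarrow> dist (?G s - f t * s) (?G t - f t * t) < \<epsilon> * ?m / 2"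
        using t(1) unfolding continuous_on_iff by metis
      show ?thesis
      proof (intro exI[of _ "min d (?m / 2)"] conjI ballI impI)
        show "0 < min d (?m / 2)" using d(1) t by simp
        fix s assume s: "s \<in> K" "\<bar>s - t\<bar> < min d (?m / 2)"
        have "\<bar>?G ?\<sigma> - ?G s - f t * (?\<sigma> - s)\<bar> = dist (?G s - f t * s) (?G t - f t * t)"
          using jumpG by (simp add: dist_real_def algebra_simps abs_minus_commute)
        also have "\<dots> \<le> \<epsilon> * (?m / 2)"
          using d(2)[OF s(1)] s(2) by (simp add: dist_real_def)
        finally have upper: "\<bar>?G ?\<sigma> - ?G s - f t * (?\<sigma> - s)\<bar> \<le> \<epsilon> * (?m / 2)" .
        have "s - t < ?m / 2" using s(2) abs_ge_self[of "s - t"] by simp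
        then have "?m / 2 \<le> \<bar>?\<sigma> - s\<bar>" using abs_ge_self[of "?\<sigma> - s"] by simp
        then have "\<epsilon> * (?m / 2) \<le> \<epsilon> * \<bar>?\<sigma> - s\<bar>"
          using \<open>\<epsilon> > 0\<close> by (intro mult_left_mono) auto
        with upper show "\<bar>?G ?\<sigma> - ?G s - f t * (?\<sigma> - s)\<bar> \<le> \<epsilon> * \<bar>?\<sigma> - s\<bar>" by simp
      qed
    next
      case False
      then have t: "right_dense K t" "t \<notin> E" using that by (auto simp: D_def)
      then have "t \<in> K" and \<sigma>: "?\<sigma> = t" by (auto simp: right_dense_def)
      obtain d where d: "d > 0" "\<And>s. s \<in> K \<Longrightarrow> dist s t < d \<Longrightarrow> dist (f s) (f t) < \<epsilon>"
        using cont[OF t] \<open>\<epsilon> > 0\<close> unfolding continuous_within_eps_delta by metis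
      show ?thesis
      proof (intro exI[of _ d] conjI ballI impI)
        fix s assume s: "s \<in> K" "\<bar>s - t\<bar> < d"
        have near: "\<bar>f r - f t\<bar> \<le> \<epsilon>" if "r \<in> K" "r \<in> {s..t} \<union> {t..s}" for r
          using d(2)[of r] that s by (auto simp: dist_real_def)
        show "\<bar>?G ?\<sigma> - ?G s - f t * (?\<sigma> - s)\<bar> \<le> \<epsilon> * \<bar>?\<sigma> - s\<bar>"
        proof (cases "s \<le> t")
          case True
          have "\<bar>?G t - ?G s - f t * (t - s)\<bar> \<le> \<epsilon> * (t - s)"
            by (rule floor_step_integral_bound[OF int s(1) \<open>t \<in> K\<close> True]) (use near \<open>\<epsilon> > 0\<close> in auto)
          then show ?thesis using True by (simp add: \<sigma>)
        next
          case False
          have "\<bar>?G s - ?G t - f t * (s - t)\<bar> \<le> \<epsilon> * (s - t)"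
            by (rule floor_step_integral_bound[OF int \<open>t \<in> K\<close> s(1)]) (use near False \<open>\<epsilon> > 0\<close> in auto)
          moreover have "?G t - ?G s - f t * (t - s) = - (?G s - ?G t - f t * (s - t))"
            by (simp add: algebra_simps)
          ultimately show ?thesis using False by (simp add: \<sigma>)
        qed
      qed (rule d(1))
    qed
  qed
  ultimately show ?thesis
    unfolding pre_antiderivative_def using contG
    by (intro conjI exI[of _ D]) (auto simp: D_def)
qed

section \<open>Delta integrability of weighted rd-continuous functions\<close>

text \<open>
  On each side of \<open>t\<close>, either a one-sided limit of \<open>f\<close> exists or \<open>K\<close> has no points
  near \<open>t\<close>.
\<close>

lemma rd_continuous_locally_bounded:
  assumes rd: "rd_continuous K f" and t: "t \<in> K"
  shows "\<exists>d>0. \<exists>M. \<forall>s\<in>K. \<bar>s - t\<bar> < d \<longrightarrow> \<bar>f s\<bar> \<le> M"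
proof -
  have "\<exists>d>0. \<exists>M. \<forall>s\<in>K. t < s \<longrightarrow> s < t + d \<longrightarrow> \<bar>f s\<bar> \<le> M"
  proof (cases "right_dense K t")
    case True
    then have "continuous (at t within K) f" using rd by (simp add: rd_continuous_def)
    then obtain d where d: "d > 0" "\<And>s. s \<in> K \<Longrightarrow> dist s t < d \<Longrightarrow> dist (f s) (f t) < 1"
      unfolding continuous_within_eps_delta by (metis zero_less_one)
    have "\<bar>f s\<bar> \<le> \<bar>f t\<bar> + 1" if "s \<in> K" "t < s" "s < t + d" for s
      using d(2)[of s] that by (simp add: dist_real_def)
    with d(1) show ?thesis by blast
  next
    case False
    then have "t < b \<Longrightarrow> right_scattered K t" using t by (simp add: right_dense_iff)
    then have "\<exists>d>0. \<forall>s\<in>K. \<not> (t < s \<and> s < t + d)"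
    proof (cases "t < b")
      case True
      with \<open>t < b \<Longrightarrow> right_scattered K t\<close> have "t < fwd_jump K t" by (simp add: right_scattered_def)
      moreover have "\<not> (t < s \<and> s < t + (fwd_jump K t - t))" if "s \<in> K" for s
        using jump_le[OF t True that] by force
      ultimately show ?thesis by (intro exI[of _ "fwd_jump K t - t"]) simp
    next
      case False
      have "\<not> t < s" if "s \<in> K" for s using that False K_sub by fastforce
      then show ?thesis by (intro exI[of _ 1]) simp
    qed
    then show ?thesis by blast
  qed
  moreover have "\<exists>d>0. \<exists>M. \<forall>s\<in>K. s < t \<longrightarrow> t - d < s \<longrightarrow> \<bar>f s\<bar> \<le> M"
  proof (cases "left_dense K t")
    case True
    then obtain l where "(f \<longlongrightarrow> l) (at t within (K \<inter> {..<t}))"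
      using rd by (auto simp: rd_continuous_def)
    then obtain d where d: "d > 0"
      "\<And>s. s \<in> K \<inter> {..<t} \<Longrightarrow> 0 < dist s t \<Longrightarrow> dist s t < d \<Longrightarrow> dist (f s) l < 1"
      unfolding Lim_within by (metis zero_less_one)
    have "\<bar>f s\<bar> \<le> \<bar>l\<bar> + 1" if "s \<in> K" "s < t" "t - d < s" for s
      using d(2)[of s] that by (simp add: dist_real_def)
    with d(1) show ?thesis by blast
  next
    case False
    have "\<exists>d>0. \<forall>s\<in>K. \<not> (s < t \<and> t - d < s)"
    proof (cases "\<exists>s\<in>K. s < t")
      case True
      let ?S = "{s \<in> K. s < t}"
      have eq: "bwd_jump K t = Sup ?S" using True by (simp add: bwd_jump_def)
      have bdd: "bdd_above ?S" by (auto intro: bdd_aboveI[of _ t])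
      have "Sup ?S \<le> t" using True by (intro cSup_least) auto
      moreover have "Sup ?S \<noteq> t" using False True t eq by (simp add: left_dense_def)
      moreover have "s \<le> Sup ?S" if "s \<in> K" "s < t" for s
        using that bdd by (intro cSup_upper) auto
      ultimately show ?thesis by (intro exI[of _ "t - Sup ?S"]) force
    next
      case False
      then show ?thesis by (intro exI[of _ 1]) simp
    qed
    then show ?thesis by blast
  qed
  ultimately obtain d1 d2 M1 M2 where d: "d1 > 0" "d2 > 0"
    and M1: "\<And>s. s \<in> K \<Longrightarrow> t < s \<Longrightarrow> s < t + d1 \<Longrightarrow> \<bar>f s\<bar> \<le> M1"
    and M2: "\<And>s. s \<in> K \<Longrightarrow> s < t \<Longrightarrow> t - d2 < s \<Longrightarrow> \<bar>f s\<bar> \<le> M2"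
    by blast
  have "\<bar>f s\<bar> \<le> max \<bar>f t\<bar> (max M1 M2)" if "s \<in> K" "\<bar>s - t\<bar> < min d1 d2" for s
    using M1[of s] M2[of s] that by (cases s t rule: linorder_cases) auto
  with d show ?thesis by (intro exI[of _ "min d1 d2"]) auto
qed

lemma rd_continuous_bounded:
  assumes "rd_continuous K f"
  obtains M where "0 \<le> M" "\<And>s. s \<in> K \<Longrightarrow> \<bar>f s\<bar> \<le> M"
proof -
  obtain d M where d: "\<And>t. t \<in> K \<Longrightarrow> d t > 0"
    and M: "\<And>s t. t \<in> K \<Longrightarrow> s \<in> K \<Longrightarrow> \<bar>s - t\<bar> < d t \<Longrightarrow> \<bar>f s\<bar> \<le> M t"
    using rd_continuous_locally_bounded[OF assms] by metis
  have "bounded K" using K_sub bounded_closed_interval bounded_subset by blast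
  then have "compact K" using closed_K by (simp add: compact_eq_bounded_closed)
  moreover have "K \<subseteq> (\<Union>t\<in>K. ball t (d t))" using d by fastforce
  ultimately obtain C where C: "C \<subseteq> K" "finite C" "K \<subseteq> (\<Union>t\<in>C. ball t (d t))"
    by (elim compactE_image) auto
  have "\<bar>f s\<bar> \<le> (\<Sum>t\<in>C. \<bar>M t\<bar>)" if s: "s \<in> K" for s
  proof -
    obtain t where t: "t \<in> C" "s \<in> ball t (d t)" using C(3) s by blast
    then have "\<bar>s - t\<bar> < d t" by (simp add: dist_real_def abs_minus_commute)
    then have "\<bar>f s\<bar> \<le> \<bar>M t\<bar>" using M[of t s] t C(1) s by force
    also have "\<dots> \<le> (\<Sum>t\<in>C. \<bar>M t\<bar>)"
      using C(2) t(1) by (intro member_le_sum) auto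
    finally show ?thesis .
  qed
  then show thesis by (intro that[of "\<Sum>t\<in>C. \<bar>M t\<bar>"]) (auto intro: sum_nonneg)
qed

text \<open>
  \<open>f\<close> is continuous on \<open>K\<close> apart from the countable set consisting of \<open>b\<close> and the
  right-scattered points, hence Borel on \<open>K\<close>; and \<open>ts_floor K\<close> is Borel because it is monotone.
\<close>

lemma rd_continuous_floor_measurable:
  assumes "rd_continuous K f"
  shows "(\<lambda>x. f (ts_floor K x)) \<in> borel_measurable (lebesgue_on {a..b})"
proof -
  let ?X = "insert b {t. right_scattered K t}"
  have X: "countable ?X" using countable_right_scattered by simp
  have "continuous_on (K - ?X) f"
    unfolding continuous_on_eq_continuous_within
  proof
    fix t assume t: "t \<in> K - ?X"
    then have "t < b" using K_sub by force
    then have "right_dense K t" using t by (simp add: right_dense_iff)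
    then have "continuous (at t within K) f" using assms by (simp add: rd_continuous_def)
    then show "continuous (at t within K - ?X) f" by (rule continuous_within_subset) auto
  qed
  moreover have "K - ?X \<in> sets borel"
    using closed_K X by (intro sets.Diff) (auto intro: borel_closed sets.countable)
  ultimately have "(\<lambda>t. indicator (K - ?X) t *\<^sub>R f t) \<in> borel_measurable borel"
    by (intro borel_measurable_continuous_on_indicator)
  then have meas: "(\<lambda>t. if t \<in> K then f t else 0) \<in> borel_measurable borel"
    by (rule measurable_discrete_difference[where X = ?X])
       (use X in \<open>auto simp: indicator_def\<close>)
  have "mono_on {a..b} (ts_floor K)"
    by (intro mono_onI floor_mono) auto
  then have "ts_floor K \<in> borel_measurable (restrict_space borel {a..b})"
    by (rule borel_measurable_mono_on_fnc)
  from measurable_compose[OF this meas]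
  have "(\<lambda>x. if ts_floor K x \<in> K then f (ts_floor K x) else 0) \<in> borel_measurable (restrict_space borel {a..b})" .
  then have "(\<lambda>x. f (ts_floor K x)) \<in> borel_measurable (restrict_space borel {a..b})"
    by (rule measurable_cong[THEN iffD1, rotated]) (simp add: floor_in)
  then have "(\<lambda>x. f (ts_floor K x)) \<in> borel_measurable (restrict_space lborel {a..b})"
    by (simp cong: measurable_cong_sets add: sets_restrict_space)
  then show ?thesis
    by (simp add: borel_measurable_restrict_space_iff measurable_completion)
qed

text \<open>
  Henstock-Kurzweil integrability is not preserved by bounded measurable factors, absolute
  integrability is; this is where \<open>w \<ge> 0\<close> enters. The set \<open>E\<close> admits a singularity of \<open>w\<close>.
\<close>

lemma delta_integrable_rd_continuous_mult:
  assumes f: "rd_continuous K f" and w: "delta_integrable K w" and w0: "\<And>t. t \<in> K \<Longrightarrow> 0 \<le> w t"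
    and E: "countable E"
    and cont: "\<And>t. right_dense K t \<Longrightarrow> t \<notin> E \<Longrightarrow> continuous (at t within K) w"
  shows "delta_integrable K (\<lambda>t. f t * w t)"
proof -
  obtain M where M: "0 \<le> M" "\<And>s. s \<in> K \<Longrightarrow> \<bar>f s\<bar> \<le> M"
    using rd_continuous_bounded[OF f] by blast
  obtain W where "pre_antiderivative K w W" using w by (auto simp: delta_integrable_def)
  then have int: "(\<lambda>x. w (ts_floor K x)) integrable_on {a..b}"
    by (rule has_integral_integrable[OF pre_antiderivative_has_integral])
  have "(\<lambda>x. w (ts_floor K x)) absolutely_integrable_on {a..b}"
    using int by (rule nonnegative_absolutely_integrable_1) (simp add: w0 floor_in)
  then have "(\<lambda>x. w (ts_floor K x)) \<in> borel_measurable (lebesgue_on {a..b})"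
    by (rule absolutely_integrable_imp_borel_measurable) simp
  with rd_continuous_floor_measurable[OF f]
  have "(\<lambda>x. f (ts_floor K x) * w (ts_floor K x)) absolutely_integrable_on {a..b}"
  proof (intro measurable_bounded_by_integrable_imp_absolutely_integrable borel_measurable_times)
    show "(\<lambda>x. M * w (ts_floor K x)) integrable_on {a..b}"
      using integrable_cmul[OF int, of M] by simp
    show "norm (f (ts_floor K x) * w (ts_floor K x)) \<le> M * w (ts_floor K x)" if "x \<in> {a..b}" for x
    proof -
      have "ts_floor K x \<in> K" using that by (simp add: floor_in)
      then show ?thesis using M(2)[of "ts_floor K x"] w0[of "ts_floor K x"] by (simp add: abs_mult mult_right_mono)
    qed
  qed auto
  then have "(\<lambda>x. f (ts_floor K x) * w (ts_floor K x)) integrable_on {a..b}"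
    by (rule set_lebesgue_integral_eq_integral)
  then have "pre_antiderivative K (\<lambda>t. f t * w t)
      (\<lambda>t. integral {a..t} (\<lambda>x. f (ts_floor K x) * w (ts_floor K x)))"
  proof (rule pre_antiderivative_integral[OF _ E])
    fix t assume "right_dense K t" "t \<notin> E"
    with f cont show "continuous (at t within K) (\<lambda>t. f t * w t)"
      by (intro continuous_mult) (auto simp: rd_continuous_def)
  qed
  then show ?thesis by (auto simp: delta_integrable_def)
qed

lemma delta_integrable_const_one: "delta_integrable K (\<lambda>t. 1)"
proof -
  have "pre_antiderivative K (\<lambda>t. 1) (\<lambda>t. t)"
    unfolding pre_antiderivative_def has_delta_derivative_def
    by (intro conjI exI[of _ "ts_kappa K"]) (auto intro!: exI[of _ 1])
  then show ?thesis by (auto simp: delta_integrable_def)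
qed

lemma delta_indef_integral_has_integral:
  assumes "delta_integrable K f"
  shows "((\<lambda>x. f (ts_floor K x)) has_integral delta_indef_integral K f b - delta_indef_integral K f a) {a..b}"
proof (rule pre_antiderivative_has_integral)
  show "pre_antiderivative K f (delta_indef_integral K f)"
    using assms someI_ex[of "pre_antiderivative K f"]
    by (simp add: delta_integrable_def delta_indef_integral_def)
qed

end

section \<open>The fractional integral\<close>

lemma rd_continuous_compose2:
  fixes \<Phi> :: "real \<times> real \<Rightarrow> real"
  assumes "continuous_on UNIV \<Phi>" "rd_continuous T f" "rd_continuous T g"
  shows "rd_continuous T (\<lambda>t. \<Phi> (f t, g t))"
proof -
  have \<Phi>: "isCont \<Phi> z" for z
    using assms(1) continuous_on_eq_continuous_at[OF open_UNIV] by blast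
  show ?thesis
    unfolding rd_continuous_def
  proof (intro conjI allI impI)
    fix t assume "right_dense T t"
    then have "continuous (at t within T) f" "continuous (at t within T) g"
      using assms(2,3) by (auto simp: rd_continuous_def)
    then show "continuous (at t within T) (\<lambda>t. \<Phi> (f t, g t))"
      unfolding continuous_within by (intro isCont_tendsto_compose[OF \<Phi>] tendsto_Pair)
  next
    fix t assume "left_dense T t"
    then obtain l m where "(f \<longlongrightarrow> l) (at t within (T \<inter> {..<t}))" "(g \<longlongrightarrow> m) (at t within (T \<inter> {..<t}))"
      using assms(2,3) unfolding rd_continuous_def by metis
    then have "((\<lambda>t. \<Phi> (f t, g t)) \<longlongrightarrow> \<Phi> (l, m)) (at t within (T \<inter> {..<t}))"
      by (intro isCont_tendsto_compose[OF \<Phi>] tendsto_Pair)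
    then show "\<exists>l. ((\<lambda>t. \<Phi> (f t, g t)) \<longlongrightarrow> l) (at t within (T \<inter> {..<t}))" by blast
  qed
qed

lemma rd_continuous_add: "rd_continuous T f \<Longrightarrow> rd_continuous T g \<Longrightarrow> rd_continuous T (\<lambda>t. f t + g t)"
  using rd_continuous_compose2[of "\<lambda>z. fst z + snd z" T f g] by (simp add: continuous_intros)

lemma rd_continuous_powr_mult:
  assumes "p > 0" "rd_continuous T f" "rd_continuous T h"
  shows "rd_continuous T (\<lambda>t. \<bar>f t\<bar> powr p * \<bar>h t\<bar>)"
proof -
  have "continuous_on UNIV (\<lambda>z::real \<times> real. \<bar>fst z\<bar> powr p * \<bar>snd z\<bar>)"
    using assms(1) by (intro continuous_intros continuous_on_powr') auto
  from rd_continuous_compose2[OF this assms(2,3)] show ?thesis by simp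
qed

lemma frac_weight_nonneg: "0 \<le> frac_weight \<alpha> t"
  by (simp add: frac_weight_def)

lemma continuous_frac_weight:
  assumes "\<alpha> = 1 \<or> t \<noteq> 0"
  shows "continuous (at t within S) (frac_weight \<alpha>)"
proof (cases "\<alpha> = 1")
  case True
  then show ?thesis by (simp add: frac_weight_def[abs_def])
next
  case False
  then have "frac_weight \<alpha> = (\<lambda>t. t powr (\<alpha> - 1))" by (auto simp: frac_weight_def)
  then show ?thesis
    using assms False by (simp only:) (intro continuous_at_within_powr continuous_ident continuous_const, simp)
qed

context compact_time_scale
begin

lemma rd_continuous_frac_weight:
  assumes "\<alpha> = 1 \<or> 0 \<notin> K"
  shows "rd_continuous K (frac_weight \<alpha>)"
  unfolding rd_continuous_def
proof (intro conjI allI impI)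
  have cont: "continuous (at t within S) (frac_weight \<alpha>)" if "t \<in> K" for t S
    using assms that by (intro continuous_frac_weight) auto
  show "continuous (at t within K) (frac_weight \<alpha>)" if "right_dense K t" for t
    using that by (intro cont) (simp add: right_dense_def)
  show "\<exists>l. (frac_weight \<alpha> \<longlongrightarrow> l) (at t within (K \<inter> {..<t}))" if "left_dense K t" for t
    using that cont[of t "K \<inter> {..<t}"] by (auto simp: left_dense_def continuous_within)
qed

lemma frac_weight_delta_integrable:
  assumes "\<alpha> = 1 \<or> 0 \<notin> K"
  shows "delta_integrable K (frac_weight \<alpha>)"
  using delta_integrable_rd_continuous_mult[OF rd_continuous_frac_weight[OF assms] delta_integrable_const_one,
      where E = "{}"] continuous_const
  by simp

text \<open>
  The weight is discontinuous at most at \<open>0\<close>, which serves as the exceptional set.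
\<close>

lemma frac_integral_has_integral:
  assumes f: "rd_continuous K f" and w: "delta_integrable K (frac_weight \<alpha>)"
  shows "((\<lambda>x. f (ts_floor K x) * frac_weight \<alpha> (ts_floor K x)) has_integral frac_integral K \<alpha> a b f) {a..b}"
proof -
  have "delta_integrable K (\<lambda>t. f t * frac_weight \<alpha> t)"
    by (rule delta_integrable_rd_continuous_mult[OF f w frac_weight_nonneg, of "{0}"])
       (auto intro: continuous_frac_weight)
  from delta_indef_integral_has_integral[OF this] show ?thesis
    by (simp add: frac_integral_def frac_indef_integral_def)
qed

end

section \<open>The inequality of Minkowski\<close>

text \<open>
  Convexity of \<open>u \<mapsto> u\<^sup>p\<close> applied to
  \<open>(\<bar>x\<bar> + \<bar>y\<bar>) / (A + B) = A/(A+B) \<cdot> \<bar>x\<bar>/A + B/(A+B) \<cdot> \<bar>y\<bar>/B\<close>.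
\<close>

lemma powr_add_le_weighted:
  fixes A B p x y :: real
  assumes "1 \<le> p" "0 < A" "0 < B"
  shows "\<bar>x + y\<bar> powr p \<le> (A + B) powr (p - 1) * (A powr (1 - p) * \<bar>x\<bar> powr p + B powr (1 - p) * \<bar>y\<bar> powr p)"
proof -
  define \<mu> where "\<mu> = B / (A + B)"
  have \<mu>: "0 < \<mu>" "\<mu> < 1" "1 - \<mu> = A / (A + B)"
    using assms by (auto simp: \<mu>_def field_simps)
  \<comment> \<open>\<open>powr_convex\<close> speaks of positive arguments; at \<open>0\<close> the claim reduces to \<open>\<mu>\<^sup>p \<le> \<mu>\<close>.\<close>
  have convex: "((1 - \<mu>) * u + \<mu> * v) powr p \<le> (1 - \<mu>) * u powr p + \<mu> * v powr p"
    if uv: "0 \<le> u" "0 \<le> v" for u v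
  proof -
    consider "u > 0" "v > 0" | "u = 0" | "v = 0" using uv by linarith
    then show ?thesis
    proof cases
      case 1
      then show ?thesis
        using convex_onD[OF powr_convex[OF assms(1)], of \<mu> u v] \<mu> by simp
    next
      case 2
      have "\<mu> powr p \<le> \<mu> powr 1" using \<mu> assms(1) by (intro powr_mono') auto
      then show ?thesis using 2 \<mu> uv(2) assms(1) by (simp add: powr_mult mult_right_mono)
    next
      case 3
      have "(1 - \<mu>) powr p \<le> (1 - \<mu>) powr 1" using \<mu>(1,2) assms(1) by (intro powr_mono') auto
      then show ?thesis using 3 \<mu>(1,2) uv(1) assms(1) by (simp add: powr_mult mult_right_mono)
    qed
  qed
  define S where "S = A + B"
  have S: "0 < S" "1 - \<mu> = A / S" "\<mu> = B / S" using assms \<mu> by (simp_all add: S_def \<mu>_def)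
  have "\<bar>x + y\<bar> \<le> S * ((1 - \<mu>) * (\<bar>x\<bar> / A) + \<mu> * (\<bar>y\<bar> / B))"
    using assms S(1) unfolding S(2) unfolding S(3) by (simp add: distrib_left)
  then have "\<bar>x + y\<bar> powr p \<le> (S * ((1 - \<mu>) * (\<bar>x\<bar> / A) + \<mu> * (\<bar>y\<bar> / B))) powr p"
    using assms(1) by (intro powr_mono2) auto
  also have "\<dots> = S powr p * ((1 - \<mu>) * (\<bar>x\<bar> / A) + \<mu> * (\<bar>y\<bar> / B)) powr p"
    by (rule powr_mult)
  also have "\<dots> \<le> S powr p * ((1 - \<mu>) * (\<bar>x\<bar> / A) powr p + \<mu> * (\<bar>y\<bar> / B) powr p)"
    using assms by (intro mult_left_mono convex) auto
  also have "\<dots> = S powr p * (A / S * (\<bar>x\<bar> powr p / A powr p) + B / S * (\<bar>y\<bar> powr p / B powr p))"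
    using assms unfolding S(2) unfolding S(3) by (simp add: powr_divide)
  also have "\<dots> = S powr p / S * (A / A powr p * \<bar>x\<bar> powr p + B / B powr p * \<bar>y\<bar> powr p)"
    by (simp add: distrib_left ac_simps)
  also have "\<dots> = S powr (p - 1) * (A powr (1 - p) * \<bar>x\<bar> powr p + B powr (1 - p) * \<bar>y\<bar> powr p)"
    using assms S(1) by (simp add: powr_diff)
  finally show ?thesis by (simp add: S_def)
qed

text \<open>
  With \<open>A = I1\<^sup>1\<^sup>/\<^sup>p\<close> and \<open>B = I2\<^sup>1\<^sup>/\<^sup>p\<close> the hypothesis would read \<open>I \<le> (A + B)\<^sup>p\<close>. Both are enlarged by
  \<open>e/2\<close>, so that they are positive even if \<open>I1\<close> or \<open>I2\<close> vanishes.
\<close>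

lemma powr_inverse_le_add:
  fixes I I1 I2 p :: real
  assumes p: "1 < p" and nonneg: "0 \<le> I" "0 \<le> I1" "0 \<le> I2"
    and le: "\<And>A B. 0 < A \<Longrightarrow> 0 < B \<Longrightarrow> I \<le> (A + B) powr (p - 1) * (A powr (1 - p) * I1 + B powr (1 - p) * I2)"
  shows "I powr (1 / p) \<le> I1 powr (1 / p) + I2 powr (1 / p)"
proof (rule field_le_epsilon)
  fix e :: real assume "e > 0"
  define A where "A = I1 powr (1 / p) + e / 2"
  define B where "B = I2 powr (1 / p) + e / 2"
  have AB: "0 < A" "0 < B" using \<open>e > 0\<close> by (auto simp: A_def B_def add_nonneg_pos)
  have root: "J \<le> C powr p" if "J powr (1 / p) \<le> C" "0 \<le> J" for J C :: real
  proof -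
    have "J = (J powr (1 / p)) powr p" using p that by (simp add: powr_powr)
    also have "\<dots> \<le> C powr p" using p that by (intro powr_mono2) auto
    finally show ?thesis .
  qed
  have "A powr (1 - p) * I1 \<le> A powr (1 - p) * A powr p" "B powr (1 - p) * I2 \<le> B powr (1 - p) * B powr p"
    using nonneg \<open>e > 0\<close> by (auto intro!: mult_left_mono root simp: A_def B_def)
  moreover have "A powr (1 - p) * A powr p = A" "B powr (1 - p) * B powr p = B"
    using AB by (simp_all flip: powr_add)
  ultimately have "A powr (1 - p) * I1 + B powr (1 - p) * I2 \<le> A + B" by simp
  then have "I \<le> (A + B) powr (p - 1) * (A + B)"
    using le[OF AB] by (meson mult_left_mono order_trans powr_ge_zero)
  also have "\<dots> = (A + B) powr p"
    using AB by (simp add: powr_diff)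
  finally have "I powr (1 / p) \<le> ((A + B) powr p) powr (1 / p)"
    using nonneg p by (intro powr_mono2) auto
  also have "\<dots> = A + B" using AB p by (simp add: powr_powr)
  finally show "I powr (1 / p) \<le> I1 powr (1 / p) + I2 powr (1 / p) + e"
    by (simp add: A_def B_def)
qed

theorem theorem10:
  fixes T :: "real set" and \<alpha> a b p :: real and f g h :: "real \<Rightarrow> real"
  assumes "time_scale T"
    and "0 < \<alpha>" and "\<alpha> \<le> 1"
    and "a \<in> T" and "b \<in> T" and "a \<le> b"
    and "1 < p"
    and "rd_continuous (ts_interval T a b) f"
    and "rd_continuous (ts_interval T a b) g"
    and "rd_continuous (ts_interval T a b) h"
    and "\<alpha> < 1 \<and> 0 \<in> ts_interval T a b \<longrightarrow>
           delta_integrable (ts_interval T a b) (frac_weight \<alpha>)"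
  shows "(frac_integral (ts_interval T a b) \<alpha> a b
            (\<lambda>t. \<bar>f t + g t\<bar> powr p * \<bar>h t\<bar>)) powr (1 / p)
         \<le> (frac_integral (ts_interval T a b) \<alpha> a b
              (\<lambda>t. \<bar>f t\<bar> powr p * \<bar>h t\<bar>)) powr (1 / p)
         + (frac_integral (ts_interval T a b) \<alpha> a b
              (\<lambda>t. \<bar>g t\<bar> powr p * \<bar>h t\<bar>)) powr (1 / p)"
proof -
  define K where "K = ts_interval T a b"
  have "K = T \<inter> {a..b}" by (auto simp: K_def ts_interval_def)
  then interpret compact_time_scale K a b
    using assms(1,4-6) by unfold_locales (auto simp: time_scale_def)
  have rd: "rd_continuous K f" "rd_continuous K g" "rd_continuous K h"
    using assms(8-10) by (simp_all add: K_def)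
  have w: "delta_integrable K (frac_weight \<alpha>)"
    using assms(3,11) frac_weight_delta_integrable[of \<alpha>] by (fold K_def) fastforce
  let ?J = "\<lambda>u. frac_integral K \<alpha> a b (\<lambda>t. \<bar>u t\<bar> powr p * \<bar>h t\<bar>)"
  have int: "((\<lambda>x. \<bar>u (ts_floor K x)\<bar> powr p * \<bar>h (ts_floor K x)\<bar> * frac_weight \<alpha> (ts_floor K x))
      has_integral ?J u) {a..b}" if "rd_continuous K u" for u
    using assms(7) by (intro frac_integral_has_integral rd_continuous_powr_mult that rd(3) w) simp
  have nonneg: "0 \<le> ?J u" if "rd_continuous K u" for u
    using int[OF that] by (rule has_integral_nonneg) (simp add: frac_weight_nonneg)
  have rd_fg: "rd_continuous K (\<lambda>t. f t + g t)" by (intro rd_continuous_add rd)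
  have "?J (\<lambda>t. f t + g t) powr (1 / p) \<le> ?J f powr (1 / p) + ?J g powr (1 / p)"
  proof (rule powr_inverse_le_add)
    fix A B :: real assume AB: "0 < A" "0 < B"
    let ?c = "(A + B) powr (p - 1)"
    have "((\<lambda>x. ?c * (A powr (1 - p) *
              (\<bar>f (ts_floor K x)\<bar> powr p * \<bar>h (ts_floor K x)\<bar> * frac_weight \<alpha> (ts_floor K x))
            + B powr (1 - p) *
              (\<bar>g (ts_floor K x)\<bar> powr p * \<bar>h (ts_floor K x)\<bar> * frac_weight \<alpha> (ts_floor K x))))
        has_integral ?c * (A powr (1 - p) * ?J f + B powr (1 - p) * ?J g)) {a..b}"
      by (intro has_integral_mult_right has_integral_add int rd)
    with int[OF rd_fg] show "?J (\<lambda>t. f t + g t) \<le> ?c * (A powr (1 - p) * ?J f + B powr (1 - p) * ?J g)"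
    proof (rule has_integral_le)
      fix x
      let ?t = "ts_floor K x"
      have "\<bar>f ?t + g ?t\<bar> powr p * (\<bar>h ?t\<bar> * frac_weight \<alpha> ?t)
          \<le> ?c * (A powr (1 - p) * \<bar>f ?t\<bar> powr p + B powr (1 - p) * \<bar>g ?t\<bar> powr p) * (\<bar>h ?t\<bar> * frac_weight \<alpha> ?t)"
        using assms(7) AB by (intro mult_right_mono powr_add_le_weighted) (auto simp: frac_weight_nonneg)
      then show "\<bar>f ?t + g ?t\<bar> powr p * \<bar>h ?t\<bar> * frac_weight \<alpha> ?t
          \<le> ?c * (A powr (1 - p) * (\<bar>f ?t\<bar> powr p * \<bar>h ?t\<bar> * frac_weight \<alpha> ?t)
              + B powr (1 - p) * (\<bar>g ?t\<bar> powr p * \<bar>h ?t\<bar> * frac_weight \<alpha> ?t))"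
        by (simp add: algebra_simps)
    qed
  qed (use assms(7) nonneg rd rd_fg in auto)
  then show ?thesis by (simp add: K_def)
qed

end
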